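(* Let $(x_i)_{i\ge0}$ and $(y_i)_{i\ge0}$ be holonomic sequences of elements of $\mathbb C_\infty$. Then the sequence $(x_i+y_i)_{i\ge0}$ is also a holonomic sequence.
   Context: Let $q$ be a power of a prime $p$, $\theta$ transcendental over $\mathbb F_q$, and $\mathbb C_\infty$ the completion of an algebraic closure of $\mathbb F_q((\theta^{-1}))$. The Anderson ring $\mathbb C_\infty[T,\tau]$ is the ring of non-commutative polynomials in $T,\tau$ with coefficients in $\mathbb C_\infty$, where $T$ is central and $\tau a=a^q\tau$ for $a\in\mathbb C_\infty$. The power series ring $\mathbb C_\infty[[T]]$ is a left $\mathbb C_\infty[T,\tau]$-module: $T$ acts by multiplication and $\tau\big(\sum_i a_iT^i\big)=\sum_i a_i^qT^i$. A sequence $(x_i)_{i\ge0}$ with $x_i\in\mathbb C_\infty$ is called holonomic if $X=\sum_{i\ge0}x_iT^i$ satisfies $PX=0$ for some non-zero $P\in\mathbb C_\infty[T,\tau]$. *)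

theory Defs
  imports
    "HOL-Algebra.Algebraic_Closure_Type"
    "HOL-Computational_Algebra.Computational_Algebra"
    "HOL-Analysis.Abstract_Metric_Spaces"
begin

text \<open>
  For a finite field \<^typ>\<open>'f\<close> with \<open>q\<close> elements, the type \<^typ>\<open>'f fls\<close> of formal Laurent series models
  \<open>F\<^sub>q((\<theta>\<^sup>-\<^sup>1))\<close>, the series variable being \<open>\<theta>\<^sup>-\<^sup>1\<close>. The absolute value is the usual one,
  normalised by \<open>\<bar>\<theta>\<bar> = q\<close>.
\<close>

definition laurent_abs :: "'f::{field,finite} fls \<Rightarrow> real" where
  "laurent_abs f = (if f = 0 then 0 else real CARD('f) powi (- fls_subdegree f))"

text \<open>
  The completion of an algebraic closure of \<open>F\<^sub>q((\<theta>\<^sup>-\<^sup>1))\<close>, determined up to isometric isomorphism by its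
  defining properties: a field with an ultrametric absolute value for which it is complete, together
  with an embedding of \<^typ>\<open>'f fls alg_closure\<close> with dense image, such that the absolute value
  extends the one on \<open>F\<^sub>q((\<theta>\<^sup>-\<^sup>1))\<close>. The extension to the algebraic closure is unique
  as \<open>F\<^sub>q((\<theta>\<^sup>-\<^sup>1))\<close> is complete.
\<close>

locale C_infinity =
  fixes emb :: "'f::{field,finite} fls alg_closure \<Rightarrow> 'c::field"
    and absv :: "'c \<Rightarrow> real"
  assumes emb_one: "emb 1 = 1"
    and emb_add: "emb (a + b) = emb a + emb b"
    and emb_mult: "emb (a * b) = emb a * emb b"
    and absv_nonneg: "absv x \<ge> 0"
    and absv_eq_0_iff: "absv x = 0 \<longleftrightarrow> x = 0"
    and absv_mult: "absv (x * y) = absv x * absv y"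
    and absv_ultrametric: "absv (x + y) \<le> max (absv x) (absv y)"
    and absv_extends: "absv (emb (to_ac f)) = laurent_abs f"
    and emb_dense:
      "Metric_space.mtopology UNIV (\<lambda>x y. absv (x - y)) closure_of (range emb) = UNIV"
    and complete: "Metric_space.mcomplete UNIV (\<lambda>x y. absv (x - y))"
begin

text \<open>The two topological axioms refer to an actual metric space.\<close>

lemma absv_minus: "absv (- x) = absv x"
proof -
  have "absv 1 = 1"
    using absv_mult[of 1 1] absv_eq_0_iff[of 1] by simp
  moreover have "absv (-1) * absv (-1) = absv 1"
    by (simp flip: absv_mult)
  ultimately have "(absv (-1))\<^sup>2 = 1\<^sup>2"
    by (simp add: power2_eq_square)
  hence "absv (-1) = 1"
    using absv_nonneg[of "-1"] by (auto simp: power2_eq_1_iff)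
  thus ?thesis
    using absv_mult[of "-1" x] by simp
qed

lemma Metric_space_absv: "Metric_space UNIV (\<lambda>x y. absv (x - y))"
proof
  show "absv (x - z) \<le> absv (x - y) + absv (y - z)" for x y z
    using absv_ultrametric[of "x - y" "y - z"] absv_nonneg[of "x - y"] absv_nonneg[of "y - z"]
    by simp
  show "absv (x - y) = absv (y - x)" for x y
    using absv_minus[of "x - y"] by simp
qed (simp_all add: absv_nonneg absv_eq_0_iff)

end

text \<open>
  An element \<open>P\<close> of the Anderson ring \<open>C[T,\<tau>]\<close> is written \<open>\<Sum>j. P\<^sub>j \<tau>\<^sup>j\<close> with \<open>P\<^sub>j\<close> in \<open>C[T]\<close>, and is
  represented by the polynomial over \<^typ>\<open>'c poly\<close> with coefficients \<open>P\<^sub>j\<close>; the powers of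
  \<open>\<tau>\<close> stand to the right of the coefficients. The commutation rules give \<open>\<tau>\<^sup>i f = f\<^sup>(\<^sup>i\<^sup>) \<tau>\<^sup>i\<close> for \<open>f\<close> in
  \<open>C[T]\<close>, where \<open>f\<^sup>(\<^sup>i\<^sup>)\<close> arises from \<open>f\<close> by raising all coefficients to the power \<open>q\<^sup>i\<close>.
\<close>

definition frob_poly :: "nat \<Rightarrow> 'c::field poly \<Rightarrow> 'c poly" where
  "frob_poly q = map_poly (\<lambda>a. a ^ q)"

definition anderson_mult ::
    "nat \<Rightarrow> 'c::field poly poly \<Rightarrow> 'c poly poly \<Rightarrow> 'c poly poly" where
  "anderson_mult q P Q =
     (\<Sum>i\<le>Polynomial.degree P. \<Sum>j\<le>Polynomial.degree Q.
        Polynomial.monom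
          (Polynomial.coeff P i * (frob_poly q ^^ i) (Polynomial.coeff Q j)) (i + j))"

definition anderson_ring :: "nat \<Rightarrow> 'c::field poly poly ring" where
  "anderson_ring q =
     \<lparr>carrier = UNIV, monoid.mult = anderson_mult q, one = 1, ring.zero = 0, add = (+)\<rparr>"

definition fps_frob :: "nat \<Rightarrow> 'c::field fps \<Rightarrow> 'c fps" where
  "fps_frob q F = Abs_fps (\<lambda>i. fps_nth F i ^ q)"

definition anderson_act :: "nat \<Rightarrow> 'c::field poly poly \<Rightarrow> 'c fps \<Rightarrow> 'c fps" where
  "anderson_act q P F =
     (\<Sum>j\<le>Polynomial.degree P. fps_of_poly (Polynomial.coeff P j) * (fps_frob q ^^ j) F)"

definition holonomic :: "nat \<Rightarrow> (nat \<Rightarrow> 'c::field) \<Rightarrow> bool" where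
  "holonomic q x \<longleftrightarrow>
     (\<exists>P \<in> carrier (anderson_ring q).
        P \<noteq> \<zero>\<^bsub>anderson_ring q\<^esub> \<and> anderson_act q P (Abs_fps x) = 0)"

subsection \<open>Ring and module structure\<close>

text \<open>
  When the \<open>q\<close>-th power map is additive, as in characteristic \<open>p\<close> with \<open>q\<close> a power of \<open>p\<close>, the operations
  above form a ring acting on power series, with the commutation rules that define \<open>C[T,\<tau>]\<close>.
\<close>

context
  fixes q :: nat and c :: "'c::field itself"
  assumes q_pos: "q > 0" and frob_add: "\<And>a b :: 'c. (a + b) ^ q = a ^ q + b ^ q"
begin

lemma coeff_frob [simp]:
  "Polynomial.coeff (frob_poly q (f :: 'c poly)) i = Polynomial.coeff f i ^ q"
  using q_pos by (simp add: frob_poly_def coeff_map_poly)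

lemma frob_sum: "(sum g A :: 'c) ^ q = (\<Sum>i\<in>A. g i ^ q)"
  using q_pos by (induction A rule: infinite_finite_induct) (auto simp: frob_add)

lemma frob_poly_0 [simp]: "frob_poly q (0 :: 'c poly) = 0"
  and frob_poly_1 [simp]: "frob_poly q (1 :: 'c poly) = 1"
  and frob_poly_add: "frob_poly q (f + g :: 'c poly) = frob_poly q f + frob_poly q g"
  and frob_poly_mult: "frob_poly q (f * g :: 'c poly) = frob_poly q f * frob_poly q g"
  using q_pos by (auto simp: poly_eq_iff frob_add coeff_mult frob_sum power_mult_distrib)

lemma frobn_poly_0 [simp]: "(frob_poly q ^^ i) (0 :: 'c poly) = 0"
  and frobn_poly_1 [simp]: "(frob_poly q ^^ i) (1 :: 'c poly) = 1"
  and frobn_poly_add: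
    "(frob_poly q ^^ i) (f + g :: 'c poly) = (frob_poly q ^^ i) f + (frob_poly q ^^ i) g"
  and frobn_poly_mult:
    "(frob_poly q ^^ i) (f * g :: 'c poly) = (frob_poly q ^^ i) f * (frob_poly q ^^ i) g"
  by (induction i) (auto simp: frob_poly_add frob_poly_mult)

lemma fps_frob_0 [simp]: "fps_frob q (0 :: 'c fps) = 0"
  and fps_frob_add: "fps_frob q (F + G :: 'c fps) = fps_frob q F + fps_frob q G"
  and fps_frob_mult: "fps_frob q (F * G :: 'c fps) = fps_frob q F * fps_frob q G"
  and fps_frob_of_poly: "fps_frob q (fps_of_poly f :: 'c fps) = fps_of_poly (frob_poly q f)"
  using q_pos
  by (auto simp: fps_eq_iff fps_frob_def frob_add fps_mult_nth frob_sum power_mult_distrib)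

lemma fps_frobn_0 [simp]: "(fps_frob q ^^ i) (0 :: 'c fps) = 0"
  and fps_frobn_add:
    "(fps_frob q ^^ i) (F + G :: 'c fps) = (fps_frob q ^^ i) F + (fps_frob q ^^ i) G"
  and fps_frobn_mult:
    "(fps_frob q ^^ i) (F * G :: 'c fps) = (fps_frob q ^^ i) F * (fps_frob q ^^ i) G"
  and fps_frobn_of_poly:
    "(fps_frob q ^^ i) (fps_of_poly f :: 'c fps) = fps_of_poly ((frob_poly q ^^ i) f)"
  by (induction i) (auto simp: fps_frob_add fps_frob_mult fps_frob_of_poly)

lemma anderson_mult_bound:
  fixes P Q :: "'c poly poly"
  assumes "Polynomial.degree P \<le> m" "Polynomial.degree Q \<le> n"
  shows "anderson_mult q P Q = (\<Sum>i\<le>m. \<Sum>j\<le>n.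
           Polynomial.monom
             (Polynomial.coeff P i * (frob_poly q ^^ i) (Polynomial.coeff Q j)) (i + j))"
proof -
  have *: "(\<Sum>j\<le>Polynomial.degree Q. h j) = (\<Sum>j\<le>n. h j)"
    if "\<And>j. Polynomial.coeff Q j = 0 \<Longrightarrow> h j = 0" for h :: "nat \<Rightarrow> 'c poly poly"
    using assms that by (intro sum.mono_neutral_left) (auto simp: coeff_eq_0)
  have **: "(\<Sum>j\<le>Polynomial.degree P. h j) = (\<Sum>j\<le>m. h j)"
    if "\<And>j. Polynomial.coeff P j = 0 \<Longrightarrow> h j = 0" for h :: "nat \<Rightarrow> 'c poly poly"
    using assms that by (intro sum.mono_neutral_left) (auto simp: coeff_eq_0)
  show ?thesis
    unfolding anderson_mult_def by (subst **, simp) (intro sum.cong refl *, simp)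
qed

lemma anderson_act_bound:
  fixes P :: "'c poly poly"
  assumes "Polynomial.degree P \<le> m"
  shows "anderson_act q P F =
    (\<Sum>j\<le>m. fps_of_poly (Polynomial.coeff P j) * (fps_frob q ^^ j) F)"
  unfolding anderson_act_def
  using assms by (intro sum.mono_neutral_left) (auto simp: coeff_eq_0)

lemma anderson_mult_add_left:
  "anderson_mult q (P + P') (Q :: 'c poly poly) = anderson_mult q P Q + anderson_mult q P' Q"
proof -
  let ?m = "max (Polynomial.degree P) (Polynomial.degree P')"
  have "Polynomial.degree (P + P') \<le> ?m" by (rule degree_add_le_max)
  then show ?thesis
    by (simp add: anderson_mult_bound[of _ ?m Q "Polynomial.degree Q"]
        ring_distribs add_monom[symmetric] sum.distrib)
qed

lemma anderson_mult_add_right: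
  "anderson_mult q (Q :: 'c poly poly) (P + P') = anderson_mult q Q P + anderson_mult q Q P'"
proof -
  let ?m = "max (Polynomial.degree P) (Polynomial.degree P')"
  have "Polynomial.degree (P + P') \<le> ?m" by (rule degree_add_le_max)
  then show ?thesis
    by (simp add: anderson_mult_bound[of Q "Polynomial.degree Q" _ ?m]
        frobn_poly_add ring_distribs add_monom[symmetric] sum.distrib)
qed

lemma anderson_mult_monom:
  "anderson_mult q (Polynomial.monom f i) (Polynomial.monom (g :: 'c poly) j) =
     Polynomial.monom (f * (frob_poly q ^^ i) g) (i + j)"
proof -
  have "anderson_mult q (Polynomial.monom f i) (Polynomial.monom g j) =
    (\<Sum>i'\<le>i. \<Sum>j'\<le>j. if i' = i then if j' = j then
        Polynomial.monom (f * (frob_poly q ^^ i) g) (i + j) else 0 else 0)"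
    by (subst anderson_mult_bound[of _ i _ j]) (auto simp: degree_monom_le intro!: sum.cong)
  also have "\<dots> = (\<Sum>i'\<le>i. if i' = i then \<Sum>j'\<le>j. if j' = j then
        Polynomial.monom (f * (frob_poly q ^^ i) g) (i + j) else 0 else 0)"
    by (intro sum.cong) auto
  finally show ?thesis by simp
qed

lemma anderson_act_add_left:
  "anderson_act q (P + P' :: 'c poly poly) F = anderson_act q P F + anderson_act q P' F"
proof -
  let ?m = "max (Polynomial.degree P) (Polynomial.degree P')"
  have "Polynomial.degree (P + P') \<le> ?m" by (rule degree_add_le_max)
  then show ?thesis
    by (simp add: anderson_act_bound[of _ ?m] fps_of_poly_add ring_distribs sum.distrib)
qed

lemma anderson_act_add_right:
  "anderson_act q (P :: 'c poly poly) (F + G) = anderson_act q P F + anderson_act q P G"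
  by (simp add: anderson_act_def fps_frobn_add ring_distribs sum.distrib)

lemma anderson_act_monom:
  "anderson_act q (Polynomial.monom f i :: 'c poly poly) F =
     fps_of_poly f * (fps_frob q ^^ i) F"
proof -
  have "anderson_act q (Polynomial.monom f i) F =
      (\<Sum>j\<le>i. if j = i then fps_of_poly f * (fps_frob q ^^ i) F else 0)"
    unfolding anderson_act_bound[OF degree_monom_le] by (rule sum.cong) auto
  then show ?thesis by simp
qed

lemma additive_poly_eqI:
  fixes g h :: "'c poly poly \<Rightarrow> 'b::ab_group_add"
  assumes "\<And>P Q. g (P + Q) = g P + g Q" "\<And>P Q. h (P + Q) = h P + h Q"
    and "\<And>f i. g (Polynomial.monom f i) = h (Polynomial.monom f i)"
  shows "g P = h P"
proof -
  have 0: "g 0 = 0" "h 0 = 0"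
    using assms(1)[of 0 0] assms(2)[of 0 0] by simp_all
  have "g (\<Sum>i\<in>A. Polynomial.monom (u i) i) = h (\<Sum>i\<in>A. Polynomial.monom (u i) i)"
    for A :: "nat set" and u
    by (induction A rule: infinite_finite_induct) (simp_all add: assms 0)
  from this[of "Polynomial.coeff P" "{..Polynomial.degree P}"] show ?thesis
    by (simp add: poly_as_sum_of_monoms)
qed

lemma anderson_mult_assoc:
  "anderson_mult q (anderson_mult q P Q) (R :: 'c poly poly) =
   anderson_mult q P (anderson_mult q Q R)"
proof (rule additive_poly_eqI[where P = P])
  fix f i
  show "anderson_mult q (anderson_mult q (Polynomial.monom f i) Q) R =
        anderson_mult q (Polynomial.monom f i) (anderson_mult q Q R)"
  proof (rule additive_poly_eqI[where P = Q])
    fix g j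
    show "anderson_mult q (anderson_mult q (Polynomial.monom f i) (Polynomial.monom g j)) R =
          anderson_mult q (Polynomial.monom f i) (anderson_mult q (Polynomial.monom g j) R)"
      by (rule additive_poly_eqI[where P = R])
        (simp_all add: anderson_mult_add_left anderson_mult_add_right anderson_mult_monom
          frobn_poly_mult funpow_add mult.assoc add.assoc)
  qed (simp_all add: anderson_mult_add_left anderson_mult_add_right)
qed (simp_all add: anderson_mult_add_left anderson_mult_add_right)

lemma anderson_mult_1_left: "anderson_mult q 1 (P :: 'c poly poly) = P"
proof (rule additive_poly_eqI[where P = P])
  show "anderson_mult q 1 (Polynomial.monom f i) = Polynomial.monom f i" for f :: "'c poly" and i
    using anderson_mult_monom[of 1 0 f i] by simp
qed (simp_all add: anderson_mult_add_right)

lemma anderson_mult_1_right: "anderson_mult q (P :: 'c poly poly) 1 = P"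
proof (rule additive_poly_eqI[where P = P])
  show "anderson_mult q (Polynomial.monom f i) 1 = Polynomial.monom f i" for f :: "'c poly" and i
    using anderson_mult_monom[of f i 1 0] by simp
qed (simp_all add: anderson_mult_add_left)

lemma ring_anderson_ring: "ring (anderson_ring q :: 'c poly poly ring)"
proof (rule ringI)
  show "abelian_group (anderson_ring q :: 'c poly poly ring)"
  proof (rule abelian_groupI)
    fix P :: "'c poly poly"
    show "\<exists>Q\<in>carrier (anderson_ring q). Q \<oplus>\<^bsub>anderson_ring q\<^esub> P = \<zero>\<^bsub>anderson_ring q\<^esub>"
      by (rule bexI[of _ "- P"]) (simp_all add: anderson_ring_def)
  qed (simp_all add: anderson_ring_def algebra_simps)
  show "Group.monoid (anderson_ring q :: 'c poly poly ring)"
    by (rule monoidI)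
      (simp_all add: anderson_ring_def anderson_mult_assoc anderson_mult_1_left
        anderson_mult_1_right)
qed (simp_all add: anderson_ring_def anderson_mult_add_left anderson_mult_add_right)

lemma anderson_act_mult:
  "anderson_act q (anderson_mult q P Q) (F :: 'c fps) = anderson_act q P (anderson_act q Q F)"
proof (rule additive_poly_eqI[where P = P])
  fix f i
  show "anderson_act q (anderson_mult q (Polynomial.monom f i) Q) F =
        anderson_act q (Polynomial.monom f i) (anderson_act q Q F)"
    by (rule additive_poly_eqI[where P = Q])
      (simp_all add: anderson_mult_add_right anderson_act_add_left anderson_act_add_right
        anderson_mult_monom anderson_act_monom fps_of_poly_mult fps_frobn_mult
        fps_frobn_of_poly funpow_add mult.assoc)
qed (simp_all add: anderson_mult_add_left anderson_act_add_left)

text \<open>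
  The elements \<open>\<tau>\<close>, \<open>T\<close> and \<open>a\<close> (a constant) are \<open>monom 1 1\<close>, \<open>[:monom 1 1:]\<close> and \<open>[:[:a:]:]\<close>.
\<close>

lemma tau_commute:
  "anderson_mult q (Polynomial.monom 1 1) [:[:a :: 'c:]:] =
   anderson_mult q [:[:a ^ q:]:] (Polynomial.monom 1 1)"
proof -
  have "frob_poly q [:a:] = [:a ^ q:]"
    using q_pos by (auto simp: poly_eq_iff coeff_pCons split: nat.splits)
  then show ?thesis
    using anderson_mult_monom[of 1 1 "[:a:]" 0] anderson_mult_monom[of "[:a ^ q:]" 0 1 1]
    by (simp add: monom_0)
qed

lemma T_central:
  "anderson_mult q [:Polynomial.monom 1 1:] (P :: 'c poly poly) =
   anderson_mult q P [:Polynomial.monom 1 1:]"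
proof (rule additive_poly_eqI[where P = P])
  fix f :: "'c poly" and i
  have "frob_poly q (Polynomial.monom (1::'c) 1) = Polynomial.monom 1 1"
    using q_pos by (auto simp: poly_eq_iff)
  then have "(frob_poly q ^^ i) (Polynomial.monom (1::'c) 1) = Polynomial.monom 1 1"
    by (induction i) auto
  then show "anderson_mult q [:Polynomial.monom 1 1:] (Polynomial.monom f i) =
             anderson_mult q (Polynomial.monom f i) [:Polynomial.monom 1 1:]"
    using anderson_mult_monom[of "Polynomial.monom 1 1" 0 f i]
      anderson_mult_monom[of f i "Polynomial.monom 1 1" 0]
    by (simp add: monom_0 mult.commute)
qed (simp_all add: anderson_mult_add_left anderson_mult_add_right)

lemma anderson_act_T: "anderson_act q [:Polynomial.monom 1 1:] (F :: 'c fps) = fps_X * F"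
  and anderson_act_tau: "anderson_act q (Polynomial.monom 1 1) (F :: 'c fps) = fps_frob q F"
  and anderson_act_const: "anderson_act q [:[:a:]:] (F :: 'c fps) = fps_const a * F"
  using anderson_act_monom[of "Polynomial.monom 1 1" 0 F] anderson_act_monom[of 1 1 F]
    anderson_act_monom[of "[:a:]" 0 F]
  by (simp_all add: monom_0 fps_of_poly_monom fps_of_poly_const)

end

end

theory Submission
  imports Defs "HOL-Number_Theory.Residues"
begin

text \<open>
  The Anderson ring is a domain satisfying the left Ore condition: for non-zero \<open>P\<close> and \<open>Q\<close> of
  \<open>\<tau>\<close>-degrees \<open>m\<close> and \<open>n\<close>, the \<open>m + n + 2\<close> elements \<open>\<tau>\<^sup>i P\<close> (\<open>i \<le> n\<close>) and \<open>\<tau>\<^sup>j Q\<close> (\<open>j \<le> m\<close>) have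
  \<open>\<tau>\<close>-degree at most \<open>m + n\<close>, so they are linearly dependent over \<open>C[T]\<close>. Hence annihilators \<open>P\<close> of
  \<open>X\<close> and \<open>Q\<close> of \<open>Y\<close> have a non-zero common left multiple, which annihilates \<open>X + Y\<close>.
\<close>

lemma linear_dependent_of_card_gt:
  fixes f :: "'i \<Rightarrow> 'a::idom poly"
  assumes "finite I" and "n < card I"
    and "\<And>i k. i \<in> I \<Longrightarrow> n \<le> k \<Longrightarrow> Polynomial.coeff (f i) k = 0"
  shows "\<exists>c. (\<exists>i\<in>I. c i \<noteq> 0) \<and> (\<Sum>i\<in>I. Polynomial.smult (c i) (f i)) = 0"
  using assms
proof (induction n arbitrary: I f)
  case 0
  then have "f i = 0" if "i \<in> I" for i
    using that by (auto simp: poly_eq_iff)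
  moreover obtain i where "i \<in> I"
    using 0 by (metis card.empty less_irrefl all_not_in_conv)
  \<comment> \<open>With no coordinates left every \<open>f i\<close> is 0, so any non-zero scalars
    do.\<close>
  ultimately show ?case
    by (intro exI[of _ "\<lambda>_. 1"]) auto
next
  case (Suc n)
  show ?case
  proof (cases "\<forall>i\<in>I. Polynomial.coeff (f i) n = 0")
    case True
    then have "Polynomial.coeff (f i) k = 0" if "i \<in> I" "n \<le> k" for i k
      using that Suc.prems(3)[of i k] by (cases "k = n") auto
    then show ?thesis
      using Suc.prems by (intro Suc.IH) auto
  next
    case False
    then obtain i0 where i0: "i0 \<in> I" and l_nz: "Polynomial.coeff (f i0) n \<noteq> 0"
      by blast
    define l where "l = Polynomial.coeff (f i0) n"
    define J where "J = I - {i0}"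
    \<comment> \<open>Cross-multiplying with the pivot \<open>f i0\<close> clears the coefficient at
      \<open>n\<close>.\<close>
    define g where
      "g i = Polynomial.smult l (f i) - Polynomial.smult (Polynomial.coeff (f i) n) (f i0)" for i
    have J: "finite J" "I = insert i0 J" "i0 \<notin> J"
      using Suc.prems(1) i0 by (auto simp: J_def)
    have "Polynomial.coeff (g i) k = 0" if "i \<in> J" "n \<le> k" for i k
      using that Suc.prems(3)[of i k] Suc.prems(3)[of i0 k] J(2)
      by (cases "k = n") (auto simp: g_def l_def)
    moreover have "n < card J"
      using Suc.prems(2) J by simp
    ultimately obtain c where c: "\<exists>i\<in>J. c i \<noteq> 0" "(\<Sum>i\<in>J. Polynomial.smult (c i) (g i)) = 0"
      using Suc.IH[of J g] J(1) by blast
    \<comment> \<open>Read off by expanding \<open>g\<close> in the relation for \<open>c\<close>.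
      Since \<open>l\<close> is non-zero in a domain, a non-zero \<open>c i\<close> keeps
      \<open>d i\<close> non-zero.\<close>
    define d where "d i = (if i = i0 then - (\<Sum>i\<in>J. c i * Polynomial.coeff (f i) n) else l * c i)"
      for i
    have "(\<Sum>i\<in>J. Polynomial.smult (d i) (f i)) = (\<Sum>i\<in>J. Polynomial.smult (l * c i) (f i))"
      using J by (intro sum.cong) (auto simp: d_def)
    also have "Polynomial.smult (d i0) (f i0) + \<dots> = (\<Sum>i\<in>J. Polynomial.smult (c i) (g i))"
      by (simp add: d_def g_def smult_sum smult_diff_right sum_subtractf mult.commute)
    finally have "(\<Sum>i\<in>I. Polynomial.smult (d i) (f i)) = 0"
      using J c(2) by simp
    moreover have "\<exists>i\<in>I. d i \<noteq> 0"
      using c(1) J l_nz by (auto simp: d_def l_def)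
    ultimately show ?thesis
      by blast
  qed
qed

context
  fixes q :: nat and c :: "'c::field itself"
  assumes q_pos: "q > 0" and frob_add: "\<And>a b :: 'c. (a + b) ^ q = a ^ q + b ^ q"
begin

private lemmas mult_add_left = anderson_mult_add_left[OF q_pos frob_add]
private lemmas mult_add_right = anderson_mult_add_right[OF q_pos frob_add]
private lemmas mult_monom = anderson_mult_monom[OF q_pos frob_add]

lemma frobn_poly_eq_0_iff: "(frob_poly q ^^ i) (f :: 'c poly) = 0 \<longleftrightarrow> f = 0"
proof (induction i)
  case (Suc i)
  have "frob_poly q g = 0 \<longleftrightarrow> g = 0" for g :: "'c poly"
    using q_pos by (simp add: poly_eq_iff coeff_frob[OF q_pos frob_add])
  with Suc show ?case by simp
qed simp

lemma coeff_anderson_mult_monom: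
  "Polynomial.coeff (anderson_mult q (Polynomial.monom f i) (P :: 'c poly poly)) k =
     (if k < i then 0 else f * (frob_poly q ^^ i) (Polynomial.coeff P (k - i)))"
  by (rule additive_poly_eqI[OF q_pos frob_add, where P = P])
    (auto simp: mult_add_right mult_monom frobn_poly_add[OF q_pos frob_add]
      frobn_poly_0[OF q_pos frob_add] algebra_simps)

lemma anderson_mult_0_left: "anderson_mult q 0 (P :: 'c poly poly) = 0"
  using mult_add_left[of 0 0 P] unfolding add_0 by (simp only: add_cancel_right_right)

lemma anderson_mult_minus_left:
  "anderson_mult q (- A) (P :: 'c poly poly) = - anderson_mult q A P"
  using mult_add_left[of "- A" A P]
  by (simp only: left_minus anderson_mult_0_left eq_neg_iff_add_eq_0)

lemma anderson_mult_sum_left: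
  "anderson_mult q (sum g A) (P :: 'c poly poly) = (\<Sum>i\<in>A. anderson_mult q (g i) P)"
  by (induction A rule: infinite_finite_induct) (simp_all add: mult_add_left anderson_mult_0_left)

text \<open>Turns a \<open>C[T]\<close>-linear relation among the products \<tau>^i P into a left
  multiple of \<open>P\<close>.\<close>

lemma smult_anderson_mult_monom:
  "Polynomial.smult a (anderson_mult q (Polynomial.monom 1 i) (P :: 'c poly poly)) =
     anderson_mult q (Polynomial.monom a i) P"
  by (simp add: poly_eq_iff coeff_anderson_mult_monom)

text \<open>The top coefficient of the product is the leading coefficient of \<open>A\<close> times
  a Frobenius twist of that of \<open>P\<close>, and the twist is injective.\<close>

lemma anderson_mult_eq_0D:
  assumes "anderson_mult q A (P :: 'c poly poly) = 0"
  shows "A = 0 \<or> P = 0"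
proof -
  let ?a = "Polynomial.degree A" and ?p = "Polynomial.degree P"
  have "anderson_mult q A P =
      (\<Sum>i\<le>?a. anderson_mult q (Polynomial.monom (Polynomial.coeff A i) i) P)"
    by (simp add: poly_as_sum_of_monoms flip: anderson_mult_sum_left)
  then have "Polynomial.coeff (anderson_mult q A P) (?a + ?p) =
      (\<Sum>i\<le>?a. Polynomial.coeff A i * (frob_poly q ^^ i) (Polynomial.coeff P (?a + ?p - i)))"
    by (simp add: coeff_sum coeff_anderson_mult_monom)
  \<comment> \<open>For \<open>i < ?a\<close> the index \<open>?a + ?p - i\<close> exceeds
    \<open>?p\<close>, so only \<open>i = ?a\<close> survives.\<close>
  also have "\<dots> = (\<Sum>i\<le>?a. if i = ?a
      then Polynomial.lead_coeff A * (frob_poly q ^^ ?a) (Polynomial.lead_coeff P) else 0)"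
    by (intro sum.cong) (auto simp: coeff_eq_0 frobn_poly_0[OF q_pos frob_add])
  finally show ?thesis
    using assms by (simp add: frobn_poly_eq_0_iff)
qed

lemma anderson_left_ore:
  assumes "P \<noteq> 0" and "Q \<noteq> (0 :: 'c poly poly)"
  shows "\<exists>A B. anderson_mult q A P = anderson_mult q B Q \<and> anderson_mult q A P \<noteq> 0"
proof -
  let ?m = "Polynomial.degree P" and ?n = "Polynomial.degree Q"
  \<comment> \<open>A disjoint sum of index sets, because members of the two families may
    coincide.\<close>
  let ?I = "{..?n} <+> {..?m}"
  define f where "f = case_sum (\<lambda>i. anderson_mult q (Polynomial.monom 1 i) P)
    (\<lambda>j. anderson_mult q (Polynomial.monom 1 j) Q)"
  have "\<exists>c. (\<exists>i\<in>?I. c i \<noteq> 0) \<and> (\<Sum>i\<in>?I. Polynomial.smult (c i) (f i)) = 0"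
  \<comment> \<open>Degree at most \<open>?m + ?n\<close> leaves \<open>?m + ?n + 1\<close>
    coordinates, one fewer than the number of vectors.\<close>
  proof (rule linear_dependent_of_card_gt[where n = "?m + ?n + 1"])
    show "Polynomial.coeff (f i) k = 0" if "i \<in> ?I" "?m + ?n + 1 \<le> k" for i k
      using that by (auto simp: f_def coeff_anderson_mult_monom coeff_eq_0
          frobn_poly_0[OF q_pos frob_add])
  qed (simp_all add: card_Plus)
  then obtain c where c: "\<exists>i\<in>?I. c i \<noteq> 0" "(\<Sum>i\<in>?I. Polynomial.smult (c i) (f i)) = 0"
    by blast
  define A where "A = (\<Sum>i\<le>?n. Polynomial.monom (c (Inl i)) i)"
  define B where "B = (\<Sum>j\<le>?m. Polynomial.monom (c (Inr j)) j)"
  have "anderson_mult q A P + anderson_mult q B Q = (\<Sum>i\<in>?I. Polynomial.smult (c i) (f i))"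
    by (simp add: A_def B_def f_def sum.Plus smult_anderson_mult_monom anderson_mult_sum_left)
  then have eq: "anderson_mult q A P = anderson_mult q (- B) Q"
    using c(2) by (simp only: anderson_mult_minus_left eq_neg_iff_add_eq_0)
  have "A \<noteq> 0 \<or> B \<noteq> 0"
  proof -
    have "Polynomial.coeff A i = c (Inl i)" if "i \<le> ?n" for i
      using that by (simp add: A_def coeff_sum)
    moreover have "Polynomial.coeff B j = c (Inr j)" if "j \<le> ?m" for j
      using that by (simp add: B_def coeff_sum)
    ultimately show ?thesis
      using c(1) by (auto simp: Plus_def)
  qed
  \<comment> \<open>If this product vanished, so would \<open>- B\<close> times \<open>Q\<close>;
    without zero divisors both \<open>A\<close> and \<open>B\<close> would be 0.\<close>
  then have "anderson_mult q A P \<noteq> 0"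
    using assms anderson_mult_eq_0D[of A P] anderson_mult_eq_0D[of "- B" Q]
    by (auto simp only: eq neg_equal_0_iff_equal)
  with eq show ?thesis by blast
qed

lemma holonomic_add:
  fixes x y :: "nat \<Rightarrow> 'c"
  assumes "holonomic q x" and "holonomic q y"
  shows "holonomic q (\<lambda>i. x i + y i)"
proof -
  obtain P Q where P: "P \<noteq> 0" "anderson_act q P (Abs_fps x) = 0"
    and Q: "Q \<noteq> 0" "anderson_act q Q (Abs_fps y) = 0"
    using assms by (auto simp: holonomic_def anderson_ring_def)
  obtain A B where AB: "anderson_mult q A P = anderson_mult q B Q" "anderson_mult q A P \<noteq> 0"
    using anderson_left_ore[OF P(1) Q(1)] by blast
  have act_0: "anderson_act q R 0 = (0 :: 'c fps)" for R
    using anderson_act_add_right[OF q_pos frob_add, of R 0 0] unfolding add_0 by (simp only: add_cancel_right_right)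
  have "Abs_fps (\<lambda>i. x i + y i) = Abs_fps x + Abs_fps y"
    by (simp add: fps_eq_iff)
  then have "anderson_act q (anderson_mult q A P) (Abs_fps (\<lambda>i. x i + y i)) =
      anderson_act q (anderson_mult q A P) (Abs_fps x) +
      anderson_act q (anderson_mult q B Q) (Abs_fps y)"
    by (simp add: anderson_act_add_right[OF q_pos frob_add] AB(1))
  also have "\<dots> = 0"
    by (simp add: anderson_act_mult[OF q_pos frob_add] P Q act_0)
  finally show ?thesis
    using AB(2) by (auto simp: holonomic_def anderson_ring_def)
qed

end

theorem theorem6p2:
  fixes emb :: "'f::{field,finite} fls alg_closure \<Rightarrow> 'c::field"
    and absv :: "'c \<Rightarrow> real"
    and p e q :: nat
    and x y :: "nat \<Rightarrow> 'c"
  assumes "prime p" and "e > 0" and "q = p ^ e"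
    and "CARD('f) = q"
    and "C_infinity emb absv"
    and "holonomic q x" and "holonomic q y"
  shows "holonomic q (\<lambda>i. x i + y i)"
proof -
  interpret C_infinity emb absv by fact
  have "CHAR('f) dvd p ^ e"
    using CHAR_dvd_CARD[where 'a = 'f] assms(3,4) by simp
  moreover have "prime CHAR('f)"
    by (intro prime_CHAR_semidom finite_imp_CHAR_pos) simp
  ultimately have "CHAR('f) = p"
    using assms(1) by (meson prime_dvd_power primes_dvd_imp_eq)
  \<comment> \<open>The identity \<open>p = 0\<close> is carried from the finite field through
    Laurent series and the algebraic closure to \<open>'c\<close>.\<close>
  then have "of_nat p = (0 :: 'f)"
    by (metis of_nat_CHAR)
  then have "of_nat p = (0 :: 'f fls)"
    by (simp add: fls_of_nat)
  then have ac: "of_nat p = (0 :: 'f fls alg_closure)"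
    by (metis to_ac_0 to_ac_of_nat)
  have emb_0: "emb 0 = 0"
    using emb_add[of 0 0] unfolding add_0 by (simp only: add_cancel_right_right)
  have "emb (of_nat n) = of_nat n" for n
    by (induction n) (simp_all add: emb_0 emb_add emb_one)
  from this[of p] have "of_nat p = (0 :: 'c)"
    by (simp add: ac emb_0)
  then have "CHAR('c) dvd p"
    by (simp add: of_nat_eq_0_iff_char_dvd)
  \<comment> \<open>The other divisor 1 is excluded, since \<open>1 \<noteq> 0\<close> in a
    field.\<close>
  then have "CHAR('c) = p"
    using assms(1) by (auto simp: prime_nat_iff)
  \<comment> \<open>Frobenius is additive in characteristic \<open>p\<close>, which is what
    \<open>holonomic_add\<close> requires.\<close>
  with assms(1,3) have "(a + b) ^ q = a ^ q + b ^ q" for a b :: 'c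
    by (intro freshmans_dream'[where n = e]) simp_all
  then show ?thesis
    using assms(1,3,6,7) by (rule_tac holonomic_add) (simp_all add: prime_gt_0_nat)
qed

end
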